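(* Let the setting be as in the context: data process $(Z_n)_{n\in\mathbb{N}}$ with values in a metric space $\mathcal{Z}$, parameter space $\Theta$, decision space $\mathcal{X}$, continuous function $g:\mathcal{X}\times\Theta\to\mathbb{R}$ with $x\mapsto g(x,\theta)$ strictly convex for all $\theta\in\Theta$, penalty function $\ell$, and constant $r>0$. Suppose that for each $\theta\in\Theta$ the asymptotic risk measure $\phi_\theta$ and the rate function $\mathcal{I}$ satisfy the Laplace principle $$\phi_\theta[(f(Z_n))_{n\in\mathbb{N}}]=\sup_{z\in\mathcal{Z}}\{f(z)-\mathcal{I}_\theta(z)\}\qquad\text{for all } f\in\mathcal{C}(\mathcal{Z}),\ \theta\in\Theta,$$ and suppose that $\mathcal{I}:\Theta\times\mathcal{Z}\to[0,\infty]$ satisfies the regularity conditions (I), (II), (III) listed in the context. Define $$G(x,z)=\max_{\theta\in\Theta}\{g(x,\theta)-\ell^{-1}(\mathcal{I}_\theta(z)-r)\},\qquad X^\star(z)=\operatorname*{arg\,min}_{x\in\mathcal{X}}G(x,z),\qquad u^\star(z)=\min_{x\in\mathcal{X}}G(x,z)$$ for $x\in\mathcal{X}$, $z\in\mathcal{Z}$. Then: (a) $(X^\star,u^\star)$ is feasible, i.e. $X^\star\in\mathcal{C}(\mathcal{Z},\mathcal{X})$, $u^\star\in\mathcal{C}(\mathcal{Z})$, and $$\phi_\theta\big[\big(\ell(g(X^\star(Z_n),\theta)-u^\star(Z_n))\big)_{n\in\mathbb{N}}\big]\le -r\qquad\text{for all }\theta\in\Theta.$$ (b) $(X^\star,u^\star)$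 is optimal, i.e. for every other feasible pair $(X,u)$, meaning $X\in\mathcal{C}(\mathcal{Z},\mathcal{X})$, $u\in\mathcal{C}(\mathcal{Z})$ and $\phi_\theta[(\ell(g(X(Z_n),\theta)-u(Z_n)))_{n\in\mathbb{N}}]\le -r$ for all $\theta\in\Theta$, one has $u^\star(z)\le u(z)$ for all $z\in\mathcal{Z}$.
   Context: Setting. $\mathcal{Z}$ is a non-empty metric space. $\Theta$ and $\mathcal{X}$ are non-empty, metric, compact and convex (i.e. compact convex subsets of real topological vector spaces whose subspace topologies are metrizable). For each $\theta\in\Theta$, $(Z_n)_{n\in\mathbb{N}}$ is a sequence of $\mathcal{Z}$-valued random variables on a probability space $(\Omega,\mathcal{F},\mathbb{P}_\theta)$. $\mathcal{C}(A,B)$ denotes the continuous functions $A\to B$, and $\mathcal{C}(A)=\mathcal{C}(A,\mathbb{R})$. Penalty. $\ell:\mathbb{R}\to\mathbb{R}$ is an increasing continuous bijection with $\ell(0)=0$, extended by $\ell(\pm\infty)=\pm\infty$; $\ell^{-1}:[-\infty,\infty]\to[-\infty,\infty]$ is its inverse. $r>0$ is a fixed real number. Asymptotic risk measure. For each $\theta\in\Theta$, $\phi_\theta$ is a functional assigning to each sequence $(f(Z_n))_{n\in\mathbb{N}}$ with $f\in\mathcal{C}(\mathcal{Z})$ a value in $[-\infty,\infty]$. Rate function. $\mathcal{I}:\Theta\times\mathcal{Z}\to[0,\infty]$, $(\theta,z)\mapsto\mathcal{I}_\theta(z)$. Regularity conditions: (I) for every $z\in\mathcal{Z}$ there is $\theta\in\Theta$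 with $\mathcal{I}_\theta(z)<\infty$; (II) $\mathcal{I}$ is lower semicontinuous on $\Theta\times\mathcal{Z}$; (III) for every $(\theta,z)\in\Theta\times\mathcal{Z}$ with $\mathcal{I}_\theta(z)<\infty$ and every sequence $(z_n)\subseteq\mathcal{Z}$ with $z_n\to z$ there is a sequence $(\theta_n)\subseteq\Theta$ with $\theta_n\to\theta$ and $\mathcal{I}_{\theta_n}(z_n)\to\mathcal{I}_\theta(z)$. $\operatorname{arg\,min}$ denotes the unique minimizer; under the stated assumptions the maxima are attained and the minimizer exists and is unique. *)

theory Defs
  imports "HOL-Probability.Probability"
begin

text \<open>Real topological vector spaces. No separation axiom is required.\<close>

class real_tvs = real_vector + topological_ab_group_add +
  assumes tendsto_scaleR_nhds:
    "((\<lambda>p. fst p *\<^sub>R snd p) \<longlongrightarrow> c *\<^sub>R a) (nhds c \<times>\<^sub>F nhds a)"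

instance real_normed_vector \<subseteq> real_tvs
proof
  fix c :: real and a :: 'a
  show "((\<lambda>p. fst p *\<^sub>R snd p) \<longlongrightarrow> c *\<^sub>R a) (nhds c \<times>\<^sub>F nhds a)"
    by (intro tendsto_scaleR filterlim_fst filterlim_snd)
qed

definition strictly_convex_on :: "'a::real_vector set \<Rightarrow> ('a \<Rightarrow> real) \<Rightarrow> bool" where
  "strictly_convex_on S f \<longleftrightarrow>
     convex S \<and>
     (\<forall>x\<in>S. \<forall>y\<in>S. \<forall>t. x \<noteq> y \<and> 0 < t \<and> t < 1 \<longrightarrow>
        f ((1 - t) *\<^sub>R x + t *\<^sub>R y) < (1 - t) * f x + t * f y)"

text \<open>The filter \<^term>\<open>at x within S\<close> omits the point \<open>x\<close> itself, which does not affect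
  lower semicontinuity at \<open>x\<close>.\<close>

definition lower_semicontinuous_on :: "'a::topological_space set \<Rightarrow> ('a \<Rightarrow> ereal) \<Rightarrow> bool" where
  "lower_semicontinuous_on S f \<longleftrightarrow> (\<forall>x\<in>S. f x \<le> Liminf (at x within S) f)"

definition penalty :: "(real \<Rightarrow> real) \<Rightarrow> bool" where
  "penalty l \<longleftrightarrow> mono l \<and> continuous_on UNIV l \<and> bij l \<and> l 0 = 0"

definition extend_ereal :: "(real \<Rightarrow> real) \<Rightarrow> ereal \<Rightarrow> ereal" where
  "extend_ereal l e = (case e of ereal a \<Rightarrow> ereal (l a) | PInfty \<Rightarrow> \<infinity> | MInfty \<Rightarrow> -\<infinity>)"

definition penalty_inv :: "(real \<Rightarrow> real) \<Rightarrow> ereal \<Rightarrow> ereal" where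
  "penalty_inv l = inv (extend_ereal l)"

definition objective ::
  "('x \<Rightarrow> 't \<Rightarrow> real) \<Rightarrow> (real \<Rightarrow> real) \<Rightarrow> real \<Rightarrow> ('t \<Rightarrow> 'z \<Rightarrow> ereal) \<Rightarrow> 'x \<Rightarrow> 'z \<Rightarrow> 't \<Rightarrow> ereal" where
  "objective g l r I x z \<theta> = ereal (g x \<theta>) - penalty_inv l (I \<theta> z - ereal r)"

text \<open>A genuine maximum, not a supremum: the value is unspecified unless the maximum is attained.
  It is extended real because the objective equals \<open>-\<infinity>\<close> where \<open>I \<theta> z = \<infinity>\<close>.\<close>

definition G_fun ::
  "'t set \<Rightarrow> ('x \<Rightarrow> 't \<Rightarrow> real) \<Rightarrow> (real \<Rightarrow> real) \<Rightarrow> real \<Rightarrow> ('t \<Rightarrow> 'z \<Rightarrow> ereal) \<Rightarrow> 'x \<Rightarrow> 'z \<Rightarrow> ereal" where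
  "G_fun \<Theta> g l r I x z = (GREATEST v. v \<in> objective g l r I x z ` \<Theta>)"

definition X_star ::
  "'x set \<Rightarrow> 't set \<Rightarrow> ('x \<Rightarrow> 't \<Rightarrow> real) \<Rightarrow> (real \<Rightarrow> real) \<Rightarrow> real \<Rightarrow> ('t \<Rightarrow> 'z \<Rightarrow> ereal) \<Rightarrow> 'z \<Rightarrow> 'x" where
  "X_star \<X> \<Theta> g l r I z = (THE x. is_arg_min (\<lambda>x. G_fun \<Theta> g l r I x z) (\<lambda>x. x \<in> \<X>) x)"

text \<open>\<^const>\<open>real_of_ereal\<close> only changes the type here: \<open>G\<close> is finite under the assumptions
  of the theorem, as its first conclusion records.\<close>

definition u_star ::
  "'x set \<Rightarrow> 't set \<Rightarrow> ('x \<Rightarrow> 't \<Rightarrow> real) \<Rightarrow> (real \<Rightarrow> real) \<Rightarrow> real \<Rightarrow> ('t \<Rightarrow> 'z \<Rightarrow> ereal) \<Rightarrow> 'z \<Rightarrow> real" where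
  "u_star \<X> \<Theta> g l r I z =
     real_of_ereal (LEAST v. v \<in> (\<lambda>x. G_fun \<Theta> g l r I x z) ` \<X>)"

definition feasible ::
  "'x::topological_space set \<Rightarrow> 't set \<Rightarrow> ('x \<Rightarrow> 't \<Rightarrow> real) \<Rightarrow> (real \<Rightarrow> real) \<Rightarrow> real \<Rightarrow>
   ('t \<Rightarrow> (nat \<Rightarrow> 'w \<Rightarrow> real) \<Rightarrow> ereal) \<Rightarrow> (nat \<Rightarrow> 'w \<Rightarrow> 'z::topological_space) \<Rightarrow>
   ('z \<Rightarrow> 'x) \<Rightarrow> ('z \<Rightarrow> real) \<Rightarrow> bool" where
  "feasible \<X> \<Theta> g l r \<phi> Z X u \<longleftrightarrow>
     continuous_on UNIV X \<and> range X \<subseteq> \<X> \<and> continuous_on UNIV u \<and>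
     (\<forall>\<theta>\<in>\<Theta>. \<phi> \<theta> (\<lambda>n \<omega>. l (g (X (Z n \<omega>)) \<theta> - u (Z n \<omega>))) \<le> - ereal r)"

end

theory Submission
  imports Defs
begin

text \<open>
  By the Laplace principle a continuous pair \<open>(X, u)\<close> satisfies the risk constraint iff
  \<open>l (g (X z) \<theta> - u z) - I \<theta> z \<le> - r\<close> for all \<open>\<theta>\<close> and \<open>z\<close>. Applying the inverse of \<open>l\<close>, this says
  \<open>G (X z) z \<le> u z\<close> for all \<open>z\<close>, so minimising \<open>G\<close> pointwise in \<open>z\<close> is feasible and optimal
  provided that it gives continuous functions.

  Strict convexity of \<open>g\<close> passes to \<open>G\<close>, since the maximum over \<open>\<theta>\<close> is attained; hence the
  minimiser is unique. Lower semicontinuity of \<open>I\<close> and compactness of the parameter space make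
  \<open>G x\<close> upper semicontinuous; the recovery sequences make \<open>G\<close> jointly lower semicontinuous along
  sequences. Let \<open>z\<^sub>n\<close> tend to \<open>z\<close> and let \<open>W\<close> be an open neighbourhood of the minimiser at \<open>z\<close>.
  Some constant separates \<open>G (X\<^sup>* z) z\<close> strictly from the values of \<open>G\<close> at \<open>z\<close> outside \<open>W\<close>, and by
  compactness it still separates \<open>G (X\<^sup>* z) z\<^sub>n\<close> from the values of \<open>G\<close> at \<open>z\<^sub>n\<close> outside \<open>W\<close> for
  large \<open>n\<close>, so the minimiser at \<open>z\<^sub>n\<close> lies in \<open>W\<close>.
\<close>

section \<open>Compactness arguments and semicontinuity in terms of filters\<close>

text \<open>A tube lemma with a filter as second factor: finitely many of the neighbourhoods
  \<open>U x\<close> cover \<open>K\<close>, and finitely many of the conditions \<open>Q x\<close>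
  hold together eventually. \<open>F\<close> will be \<open>nhds z\<close> or
  \<open>sequentially\<close>.\<close>

lemma eventually_compact_tube:
  assumes "compact K"
    and "\<And>x. x \<in> K \<Longrightarrow> \<forall>\<^sub>F p in nhds x \<times>\<^sub>F F. fst p \<in> K \<longrightarrow> P (fst p) (snd p)"
  shows "\<forall>\<^sub>F y in F. \<forall>x\<in>K. P x y"
proof -
  have "\<exists>U Q. open U \<and> x \<in> U \<and> eventually Q F \<and> (\<forall>x'\<in>U \<inter> K. \<forall>y. Q y \<longrightarrow> P x' y)"
    if "x \<in> K" for x
    using assms(2)[OF that] unfolding eventually_prod_filter eventually_nhds by (metis IntE fst_conv snd_conv)
  then obtain U Q where UQ: "\<And>x. x \<in> K \<Longrightarrow> open (U x) \<and> x \<in> U x \<and> eventually (Q x) F \<and>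
      (\<forall>x'\<in>U x \<inter> K. \<forall>y. Q x y \<longrightarrow> P x' y)"
    by metis
  obtain D where D: "D \<subseteq> K" "finite D" "K \<subseteq> (\<Union>x\<in>D. U x)"
    using compactE_image[OF assms(1), of K U] UQ by blast
  have "\<forall>\<^sub>F y in F. \<forall>x\<in>D. Q x y"
    using D UQ by (intro eventually_ball_finite) auto
  then show ?thesis
    by eventually_elim (use D UQ in blast)
qed

text \<open>If every \<open>x\<close> had some \<open>m x\<close> with a smaller value, the points
  where \<open>f\<close> exceeds \<open>f (m x)\<close> would give an open cover of
  \<open>K\<close>. In a finite subcover take the index \<open>d\<close> with least
  \<open>f (m d)\<close>: the point \<open>m d\<close> itself lies in some \<open>U x\<close>, so
  \<open>f (m x) < f (m d)\<close>.\<close>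

lemma compact_attains_min_lsc:
  fixes f :: "'a::topological_space \<Rightarrow> ereal"
  assumes "compact K" "K \<noteq> {}"
    and ninf: "\<And>x. x \<in> K \<Longrightarrow> f x \<noteq> -\<infinity>"
    and lsc: "\<And>x c. x \<in> K \<Longrightarrow> ereal c < f x \<Longrightarrow> \<forall>\<^sub>F y in nhds x. y \<in> K \<longrightarrow> ereal c < f y"
  shows "\<exists>x\<in>K. \<forall>y\<in>K. f x \<le> f y"
proof (rule ccontr)
  assume "\<not> ?thesis"
  then have "\<exists>y\<in>K. f y < f x" if "x \<in> K" for x
    using that by (meson not_le)
  then obtain m where m: "\<And>x. x \<in> K \<Longrightarrow> m x \<in> K \<and> f (m x) < f x"
    by metis
  have "\<exists>U. open U \<and> x \<in> U \<and> (\<forall>x'\<in>U \<inter> K. f (m x) < f x')" if x: "x \<in> K" for x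
  proof -
    \<comment> \<open>\<open>lsc\<close> speaks of real thresholds only, so a real number is put
      strictly between the two extended values.\<close>
    obtain c where "f (m x) < ereal c" "ereal c < f x"
      using ereal_dense2 m[OF x] by blast
    then show ?thesis
      using lsc[OF x, of c] unfolding eventually_nhds by (meson IntE less_trans)
  qed
  then obtain U where U: "\<And>x. x \<in> K \<Longrightarrow> open (U x) \<and> x \<in> U x \<and> (\<forall>x'\<in>U x \<inter> K. f (m x) < f x')"
    by metis
  obtain D where D: "D \<subseteq> K" "finite D" "K \<subseteq> (\<Union>x\<in>D. U x)"
    using compactE_image[OF assms(1), of K U] U by blast
  then have "D \<noteq> {}" using \<open>K \<noteq> {}\<close> by auto
  then obtain d where d: "d \<in> D" "\<And>x. x \<in> D \<Longrightarrow> f (m d) \<le> f (m x)"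
    using ex_min_if_finite[of "(\<lambda>x. f (m x)) ` D"] D(2) by (auto simp: not_less)
  have "m d \<in> K" using d D m by blast
  then obtain x where "x \<in> D" "m d \<in> U x" using D by blast
  then have "f (m x) < f (m d)" using U D \<open>m d \<in> K\<close> by blast
  then show False using d(2)[OF \<open>x \<in> D\<close>] by simp
qed

text \<open>The punctured filter says nothing about \<open>x\<close> itself; there the bound is the
  assumption \<open>c < f x\<close>.\<close>

lemma lower_semicontinuous_onD:
  assumes "lower_semicontinuous_on S f" "x \<in> S" "c < f x"
  shows "\<forall>\<^sub>F y in nhds x. y \<in> S \<longrightarrow> c < f y"
proof -
  have "\<forall>\<^sub>F y in at x within S. c < f y"
    using assms unfolding lower_semicontinuous_on_def le_Liminf_iff by blast
  then show ?thesis
    unfolding eventually_at_filter by eventually_elim (use assms in auto)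
qed

lemma continuous_onD_nhds:
  assumes "continuous_on S f" "x \<in> S" "open T" "f x \<in> T"
  shows "\<forall>\<^sub>F y in nhds x. y \<in> S \<longrightarrow> f y \<in> T"
proof -
  have "\<forall>\<^sub>F y in at x within S. f y \<in> T"
    using assms unfolding continuous_on_def tendsto_def by blast
  then show ?thesis
    unfolding eventually_at_filter by eventually_elim (use assms in auto)
qed

text \<open>Sequences suffice because the domain is first countable; condition (III) provides
  information along sequences only.\<close>

lemma continuous_on_UNIV_sequentially:
  fixes f :: "'a::first_countable_topology \<Rightarrow> 'b::topological_space"
  assumes "\<And>xs x. xs \<longlonglongrightarrow> x \<Longrightarrow> (\<lambda>n. f (xs n)) \<longlonglongrightarrow> f x"
  shows "continuous_on UNIV f"
  unfolding continuous_on_def tendsto_at_iff_sequentially using assms by (auto simp: comp_def)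

section \<open>The penalty, its inverse, and thresholds for the objective\<close>

lemma penalty_strict_mono: "penalty l \<Longrightarrow> strict_mono l"
  by (auto simp: penalty_def bij_def strict_mono_iff_mono)

lemma penalty_less_iff: "penalty l \<Longrightarrow> l a < l b \<longleftrightarrow> a < b"
  using penalty_strict_mono strict_mono_less by blast

lemma inj_extend_ereal:
  assumes "penalty l" shows "inj (extend_ereal l)"
proof (rule injI)
  fix a b assume "extend_ereal l a = extend_ereal l b"
  then show "a = b"
    using assms unfolding penalty_def bij_def
    by (cases a; cases b) (auto simp: extend_ereal_def dest: injD)
qed

lemma penalty_inv_ereal: "penalty l \<Longrightarrow> penalty_inv l (ereal (l a)) = ereal a"
  unfolding penalty_inv_def by (rule inv_f_eq[OF inj_extend_ereal]) (auto simp: extend_ereal_def)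

lemma penalty_inv_PInfty: "penalty l \<Longrightarrow> penalty_inv l \<infinity> = \<infinity>"
  unfolding penalty_inv_def by (rule inv_f_eq[OF inj_extend_ereal]) (auto simp: extend_ereal_def)

lemma penalty_inv_MInfty: "penalty l \<Longrightarrow> penalty_inv l (-\<infinity>) = -\<infinity>"
  unfolding penalty_inv_def by (rule inv_f_eq[OF inj_extend_ereal]) (auto simp: extend_ereal_def)

text \<open>Surjectivity of \<open>l\<close> writes a finite \<open>e\<close> as \<open>l b\<close>,
  after which strict monotonicity decides; the infinite cases are immediate.\<close>

lemma penalty_inv_less_iff:
  assumes "penalty l" shows "penalty_inv l e < ereal c \<longleftrightarrow> e < ereal (l c)"
proof (cases e)
  case (real a)
  moreover obtain b where "a = l b"
    using assms unfolding penalty_def bij_def by (metis surjD)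
  ultimately show ?thesis
    using assms by (simp add: penalty_inv_ereal penalty_less_iff)
qed (use assms in \<open>simp_all add: penalty_inv_PInfty penalty_inv_MInfty\<close>)

lemma penalty_inv_greater_iff:
  assumes "penalty l" shows "ereal c < penalty_inv l e \<longleftrightarrow> ereal (l c) < e"
proof (cases e)
  case (real a)
  moreover obtain b where "a = l b"
    using assms unfolding penalty_def bij_def by (metis surjD)
  ultimately show ?thesis
    using assms by (simp add: penalty_inv_ereal penalty_less_iff)
qed (use assms in \<open>simp_all add: penalty_inv_PInfty penalty_inv_MInfty\<close>)

text \<open>This moves the inverse penalty and the extended arithmetic out of the way: what remains
  compares the rate with a real threshold that is continuous in \<open>x\<close> and \<theta>.
  Semicontinuity of \<open>I\<close> thus passes to the objective without discussing continuity of
  \<open>penalty_inv\<close>.\<close>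

lemma objective_less_iff:
  assumes "penalty l"
  shows "objective g l r I x z \<theta> < ereal c \<longleftrightarrow> ereal (l (g x \<theta> - c) + r) < I \<theta> z"
proof -
  have "objective g l r I x z \<theta> < ereal c \<longleftrightarrow> ereal (g x \<theta> - c) < penalty_inv l (I \<theta> z - ereal r)"
    unfolding objective_def by (cases "penalty_inv l (I \<theta> z - ereal r)") auto
  also have "\<dots> \<longleftrightarrow> ereal (l (g x \<theta> - c) + r) < I \<theta> z"
    unfolding penalty_inv_greater_iff[OF assms] by (cases "I \<theta> z") auto
  finally show ?thesis .
qed

lemma objective_greater_iff:
  assumes "penalty l"
  shows "ereal c < objective g l r I x z \<theta> \<longleftrightarrow> I \<theta> z < ereal (l (g x \<theta> - c) + r)"
proof -
  have "ereal c < objective g l r I x z \<theta> \<longleftrightarrow> penalty_inv l (I \<theta> z - ereal r) < ereal (g x \<theta> - c)"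
    unfolding objective_def by (cases "penalty_inv l (I \<theta> z - ereal r)") auto
  also have "\<dots> \<longleftrightarrow> I \<theta> z < ereal (l (g x \<theta> - c) + r)"
    unfolding penalty_inv_less_iff[OF assms] by (cases "I \<theta> z") auto
  finally show ?thesis .
qed

text \<open>The right-hand side bounds one term of the supremum in the Laplace principle.\<close>

lemma objective_le_iff:
  assumes "penalty l"
  shows "objective g l r I x z \<theta> \<le> ereal c \<longleftrightarrow> ereal (l (g x \<theta> - c)) - I \<theta> z \<le> - ereal r"
  unfolding not_less[symmetric] objective_greater_iff[OF assms]
  by (cases "I \<theta> z") auto

lemma objective_PInfty:
  "penalty l \<Longrightarrow> I \<theta> z = \<infinity> \<Longrightarrow> objective g l r I x z \<theta> = -\<infinity>"
  by (simp add: objective_def penalty_inv_PInfty)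

text \<open>The constant \<kappa> does not depend on \<open>x\<close>, so at a parameter of finite
  rate the objective is a translate of \<open>g\<close> and inherits its strict convexity.\<close>

lemma objective_finite:
  assumes "penalty l" "\<bar>I \<theta> z\<bar> \<noteq> \<infinity>"
  shows "\<exists>\<kappa>. \<forall>x. objective g l r I x z \<theta> = ereal (g x \<theta> - \<kappa>)"
proof -
  obtain i where i: "I \<theta> z = ereal i" using assms(2) by auto
  obtain \<kappa> where "i - r = l \<kappa>"
    using assms(1) unfolding penalty_def bij_def by (metis surjD)
  then have "penalty_inv l (I \<theta> z - ereal r) = ereal \<kappa>"
    using assms(1) by (simp add: i penalty_inv_ereal)
  then show ?thesis by (intro exI[of _ \<kappa>]) (simp add: objective_def)
qed

section \<open>The deterministic min-max problem\<close>

locale robust_problem =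
  fixes \<Theta> :: "'t::topological_space set" and \<X> :: "'x::real_tvs set"
    and g :: "'x \<Rightarrow> 't \<Rightarrow> real" and l :: "real \<Rightarrow> real" and r :: real
    and I :: "'t \<Rightarrow> 'z::metric_space \<Rightarrow> ereal"
  assumes compact_Theta: "compact \<Theta>"
    and X: "\<X> \<noteq> {}" "compact \<X>" "convex \<X>"
    and g_cont: "continuous_on (\<X> \<times> \<Theta>) (\<lambda>(x, \<theta>). g x \<theta>)"
    and g_convex: "\<And>\<theta>. \<theta> \<in> \<Theta> \<Longrightarrow> strictly_convex_on \<X> (\<lambda>x. g x \<theta>)"
    and l: "penalty l"
    and I_nonneg: "\<And>\<theta> z. \<theta> \<in> \<Theta> \<Longrightarrow> 0 \<le> I \<theta> z"
    and I_finite: "\<And>z. \<exists>\<theta>\<in>\<Theta>. I \<theta> z < \<infinity>"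
    and I_lsc: "lower_semicontinuous_on (\<Theta> \<times> UNIV) (\<lambda>(\<theta>, z). I \<theta> z)"
    and I_recovery: "\<And>\<theta> z zs. \<theta> \<in> \<Theta> \<Longrightarrow> I \<theta> z < \<infinity> \<Longrightarrow> zs \<longlonglongrightarrow> z \<Longrightarrow>
        \<exists>\<theta>s. (\<forall>n. \<theta>s n \<in> \<Theta>) \<and> \<theta>s \<longlonglongrightarrow> \<theta> \<and> (\<lambda>n. I (\<theta>s n) (zs n)) \<longlonglongrightarrow> I \<theta> z"
begin

abbreviation "h \<equiv> objective g l r I"
abbreviation "G \<equiv> G_fun \<Theta> g l r I"
abbreviation "Xs \<equiv> X_star \<X> \<Theta> g l r I"
abbreviation "us \<equiv> u_star \<X> \<Theta> g l r I"

lemma lg_cont: "continuous_on (\<X> \<times> \<Theta>) (\<lambda>p. l (g (fst p) (snd p) - c) + r)"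
proof -
  have "continuous_on (\<X> \<times> \<Theta>) (\<lambda>p. g (fst p) (snd p) - c)"
    using g_cont by (intro continuous_intros) (simp add: case_prod_beta)
  moreover have "continuous_on UNIV l" using l by (simp add: penalty_def)
  ultimately have "continuous_on (\<X> \<times> \<Theta>) (\<lambda>p. l (g (fst p) (snd p) - c))"
    using continuous_on_compose2[of UNIV l] by blast
  then show ?thesis by (intro continuous_intros)
qed

lemma objective_usc:
  assumes x: "x \<in> \<X>" and \<theta>: "\<theta> \<in> \<Theta>" and less: "h x z \<theta> < ereal c"
  shows "\<forall>\<^sub>F p in nhds \<theta> \<times>\<^sub>F nhds z. fst p \<in> \<Theta> \<longrightarrow> h x (snd p) (fst p) < ereal c"
proof -
  \<comment> \<open>The real \<open>d\<close> decouples the two sides: lower semicontinuity keeps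
    the rate above \<open>d\<close>, continuity keeps the threshold below \<open>d\<close>.\<close>
  obtain d where d: "l (g x \<theta> - c) + r < d" "ereal d < I \<theta> z"
    using less ereal_dense2 unfolding objective_less_iff[OF l] by (metis less_ereal.simps(1))
  have "\<forall>\<^sub>F p in nhds \<theta> \<times>\<^sub>F nhds z. p \<in> \<Theta> \<times> UNIV \<longrightarrow> ereal d < (case p of (\<theta>, z) \<Rightarrow> I \<theta> z)"
    using lower_semicontinuous_onD[OF I_lsc, of "(\<theta>, z)"] d \<theta> unfolding nhds_prod by auto
  moreover
  have "continuous_on \<Theta> (\<lambda>\<theta>. l (g x \<theta> - c) + r)"
    using continuous_on_compose2[OF lg_cont continuous_on_Pair[OF continuous_on_const[of _ x] continuous_on_id]] x
    by (auto simp: image_subset_iff)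
  from continuous_onD_nhds[OF this \<theta> open_lessThan[of d]]
  have "\<forall>\<^sub>F \<theta>' in nhds \<theta>. \<theta>' \<in> \<Theta> \<longrightarrow> l (g x \<theta>' - c) + r < d"
    using d by auto
  then have "\<forall>\<^sub>F p in nhds \<theta> \<times>\<^sub>F nhds z. fst p \<in> \<Theta> \<longrightarrow> l (g x (fst p) - c) + r < d"
    by (rule eventually_compose_filterlim[OF _ filterlim_fst])
  ultimately show ?thesis
    by eventually_elim (auto simp: objective_less_iff[OF l] intro: less_trans[of _ "ereal d"])
qed

lemma objective_not_PInfty: "\<theta> \<in> \<Theta> \<Longrightarrow> h x z \<theta> \<noteq> \<infinity>"
proof (cases "I \<theta> z = \<infinity>")
  case True
  then show ?thesis by (simp add: objective_PInfty[OF l])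
next
  case False
  assume "\<theta> \<in> \<Theta>"
  then have "\<bar>I \<theta> z\<bar> \<noteq> \<infinity>" using False I_nonneg[of \<theta> z] by auto
  from objective_finite[of l I \<theta> z g r, OF l this] show ?thesis by auto
qed

lemma objective_attains_max:
  assumes x: "x \<in> \<X>"
  obtains \<theta> where "\<theta> \<in> \<Theta>" "\<And>\<theta>'. \<theta>' \<in> \<Theta> \<Longrightarrow> h x z \<theta>' \<le> h x z \<theta>"
proof -
  \<comment> \<open>Maximising an upper semicontinuous function is minimising its negative.\<close>
  have "\<exists>\<theta>\<in>\<Theta>. \<forall>\<theta>'\<in>\<Theta>. - h x z \<theta> \<le> - h x z \<theta>'"
  proof (rule compact_attains_min_lsc[OF compact_Theta])
    show "\<Theta> \<noteq> {}" using I_finite by auto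
    show "- h x z \<theta> \<noteq> -\<infinity>" if "\<theta> \<in> \<Theta>" for \<theta>
      using objective_not_PInfty[OF that] by simp
    fix \<theta> c assume \<theta>: "\<theta> \<in> \<Theta>" and "ereal c < - h x z \<theta>"
    then have "h x z \<theta> < ereal (-c)" by (cases "h x z \<theta>") auto
    \<comment> \<open>Composing with \<theta>' \<mapsto> (\<theta>', z) restricts the joint
      statement to the slice at fixed \<open>z\<close>.\<close>
    from eventually_compose_filterlim[OF objective_usc[OF x \<theta> this]
        filterlim_Pair[OF filterlim_ident tendsto_const]]
    have "\<forall>\<^sub>F \<theta>' in nhds \<theta>. \<theta>' \<in> \<Theta> \<longrightarrow> h x z \<theta>' < ereal (-c)"
      by simp
    then show "\<forall>\<^sub>F \<theta>' in nhds \<theta>. \<theta>' \<in> \<Theta> \<longrightarrow> ereal c < - h x z \<theta>'"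
    proof eventually_elim
      case (elim \<theta>')
      then show ?case by (cases "h x z \<theta>'") auto
    qed
  qed
  then show ?thesis using that by auto
qed

lemma objective_arg_max: "x \<in> \<X> \<Longrightarrow> \<exists>\<theta>. is_arg_max (h x z) (\<lambda>\<theta>. \<theta> \<in> \<Theta>) \<theta>"
  unfolding is_arg_max_linorder by (metis objective_attains_max)

lemma G_eqI:
  assumes "\<theta> \<in> \<Theta>" "\<And>\<theta>'. \<theta>' \<in> \<Theta> \<Longrightarrow> h x z \<theta>' \<le> h x z \<theta>"
  shows "G x z = h x z \<theta>"
  unfolding G_fun_def using assms by (intro Greatest_equality) auto

lemma G_attained:
  assumes "x \<in> \<X>"
  obtains \<theta> where "\<theta> \<in> \<Theta>" "G x z = h x z \<theta>"
  using objective_attains_max[OF assms, of z] G_eqI that by metis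

lemma objective_le_G:
  assumes "x \<in> \<X>" "\<theta> \<in> \<Theta>"
  shows "h x z \<theta> \<le> G x z"
  using objective_attains_max[OF assms(1), of z] G_eqI assms(2) by metis

text \<open>Condition (I) supplies a parameter with finite objective, which bounds \<open>G\<close>
  from below; from above, \<open>G\<close> is an attained value and the objective is never
  \<infinity>.\<close>

lemma G_finite:
  assumes x: "x \<in> \<X>" shows "\<bar>G x z\<bar> \<noteq> \<infinity>"
proof -
  obtain \<theta> where \<theta>: "\<theta> \<in> \<Theta>" "I \<theta> z < \<infinity>" using I_finite by blast
  then have "\<bar>I \<theta> z\<bar> \<noteq> \<infinity>" using I_nonneg[of \<theta> z] by auto
  from objective_finite[of l I \<theta> z g r, OF l this]
  have "h x z \<theta> \<noteq> -\<infinity>" by auto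
  then have "G x z \<noteq> -\<infinity>" using objective_le_G[OF x \<theta>(1), of z] by auto
  moreover have "G x z \<noteq> \<infinity>" using G_attained[OF x, of z] objective_not_PInfty by metis
  ultimately show ?thesis by auto
qed

text \<open>A maximiser has finite rate, since otherwise \<open>G\<close> would be -\<infinity>.
  Hence recovery sequences exist at it.\<close>

lemma G_attained_finite:
  assumes x: "x \<in> \<X>"
  obtains \<theta> \<kappa> where "\<theta> \<in> \<Theta>" "I \<theta> z < \<infinity>" "G x z = h x z \<theta>" "\<And>y. h y z \<theta> = ereal (g y \<theta> - \<kappa>)"
proof -
  obtain \<theta> where \<theta>: "\<theta> \<in> \<Theta>" "G x z = h x z \<theta>" using G_attained[OF x] by blast
  then have fin: "I \<theta> z \<noteq> \<infinity>"
    using G_finite[OF x, of z] objective_PInfty[OF l, of I \<theta> z g r x] by auto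
  then have "\<bar>I \<theta> z\<bar> \<noteq> \<infinity>" using I_nonneg[OF \<theta>(1), of z] by auto
  then obtain \<kappa> where "\<And>y. h y z \<theta> = ereal (g y \<theta> - \<kappa>)"
    using objective_finite[OF l, of I \<theta> z g r] by auto
  with \<theta> fin show ?thesis by (intro that) auto
qed

section \<open>Semicontinuity of the worst-case value\<close>

text \<open>The tube lemma bounds the objective strictly for all \<theta> at once, and the bound
  stays strict for \<open>G\<close> because the maximum is attained.\<close>

lemma G_usc:
  assumes x: "x \<in> \<X>" and less: "G x z < ereal c"
  shows "\<forall>\<^sub>F z' in nhds z. G x z' < ereal c"
proof -
  have "\<forall>\<^sub>F z' in nhds z. \<forall>\<theta>\<in>\<Theta>. h x z' \<theta> < ereal c"
    using less objective_le_G[OF x]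
    by (intro eventually_compact_tube compact_Theta objective_usc x) (auto intro: le_less_trans)
  then show ?thesis by eventually_elim (metis G_attained[OF x])
qed

text \<open>A maximiser \<theta> at \<open>z\<close> has a recovery sequence along
  \<open>zs\<close>, and its members are competitors in the maxima defining \<open>G\<close> at
  \<open>zs n\<close>. The product filter lets the decision vary in a neighbourhood while the state
  runs along a sequence, as the tube lemma requires.\<close>

lemma G_lsc:
  assumes x: "x \<in> \<X>" and zs: "zs \<longlonglongrightarrow> z" and less: "ereal c < G x z"
  shows "\<forall>\<^sub>F p in nhds x \<times>\<^sub>F sequentially. fst p \<in> \<X> \<longrightarrow> ereal c < G (fst p) (zs (snd p))"
proof -
  obtain \<theta> where \<theta>: "\<theta> \<in> \<Theta>" "I \<theta> z < \<infinity>" "G x z = h x z \<theta>"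
    using G_attained_finite[OF x] by metis
  obtain \<theta>s where \<theta>s: "\<And>n. \<theta>s n \<in> \<Theta>" "\<theta>s \<longlonglongrightarrow> \<theta>" "(\<lambda>n. I (\<theta>s n) (zs n)) \<longlonglongrightarrow> I \<theta> z"
    using I_recovery[OF \<theta>(1,2) zs] by blast
  obtain d where d: "I \<theta> z < ereal d" "d < l (g x \<theta> - c) + r"
    using less ereal_dense2 unfolding \<theta>(3) objective_greater_iff[OF l] by (metis less_ereal.simps(1))
  have "\<forall>\<^sub>F n in sequentially. I (\<theta>s n) (zs n) < ereal d"
    using order_tendstoD(2)[OF \<theta>s(3) d(1)] .
  then have "\<forall>\<^sub>F p in nhds x \<times>\<^sub>F sequentially. I (\<theta>s (snd p)) (zs (snd p)) < ereal d"
    by (rule eventually_compose_filterlim[OF _ filterlim_snd])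
  moreover
  \<comment> \<open>The pairs of a decision near \<open>x\<close> and the recovery parameter
    \<open>\<theta>s n\<close> tend to \<open>(x, \<theta>)\<close>, so joint continuity of the
    threshold applies along them.\<close>
  have "\<forall>\<^sub>F q in nhds (x, \<theta>). q \<in> \<X> \<times> \<Theta> \<longrightarrow> l (g (fst q) (snd q) - c) + r \<in> {d<..}"
    using d x \<theta> by (intro continuous_onD_nhds[OF lg_cont]) auto
  then have "\<forall>\<^sub>F p in nhds x \<times>\<^sub>F sequentially. (fst p, \<theta>s (snd p)) \<in> \<X> \<times> \<Theta> \<longrightarrow>
      l (g (fst (fst p, \<theta>s (snd p))) (snd (fst p, \<theta>s (snd p))) - c) + r \<in> {d<..}"
    unfolding nhds_prod
    by (rule eventually_compose_filterlim)
      (intro filterlim_Pair filterlim_fst filterlim_compose[OF \<theta>s(2) filterlim_snd])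
  ultimately show ?thesis
  proof eventually_elim
    case (elim p)
    show ?case
    proof
      assume p: "fst p \<in> \<X>"
      with elim \<theta>s(1) have "I (\<theta>s (snd p)) (zs (snd p)) < ereal (l (g (fst p) (\<theta>s (snd p)) - c) + r)"
        by (auto intro: less_trans[of _ "ereal d"])
      then have "ereal c < h (fst p) (zs (snd p)) (\<theta>s (snd p))"
        by (simp add: objective_greater_iff[OF l])
      then show "ereal c < G (fst p) (zs (snd p))"
        using objective_le_G[OF p \<theta>s(1)] by (rule less_le_trans)
    qed
  qed
qed

lemma G_lsc_uniform:
  assumes K: "compact K" "K \<subseteq> \<X>" and zs: "zs \<longlonglongrightarrow> z" and less: "\<And>x. x \<in> K \<Longrightarrow> ereal c < G x z"
  shows "\<forall>\<^sub>F n in sequentially. \<forall>x\<in>K. ereal c < G x (zs n)"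
proof (rule eventually_compact_tube[OF K(1)])
  fix x assume x: "x \<in> K"
  then have "\<forall>\<^sub>F p in nhds x \<times>\<^sub>F sequentially. fst p \<in> \<X> \<longrightarrow> ereal c < G (fst p) (zs (snd p))"
    using K less zs by (intro G_lsc) auto
  then show "\<forall>\<^sub>F p in nhds x \<times>\<^sub>F sequentially. fst p \<in> K \<longrightarrow> ereal c < G (fst p) (zs (snd p))"
    by eventually_elim (use K in blast)
qed

text \<open>A general compact \<open>K\<close> is allowed because the minimum is also taken over
  \<X> with a neighbourhood of the minimiser removed.\<close>

lemma G_attains_min:
  assumes K: "compact K" "K \<subseteq> \<X>" "K \<noteq> {}"
  shows "\<exists>x\<in>K. \<forall>y\<in>K. G x z \<le> G y z"
proof (rule compact_attains_min_lsc[OF K(1,3)])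
  show "G x z \<noteq> -\<infinity>" if "x \<in> K" for x using G_finite[of x z] that K by auto
  fix x c assume x: "x \<in> K" and less: "ereal c < G x z"
  \<comment> \<open>A constant sequence of states turns \<open>G_lsc\<close> into lower
    semicontinuity in the decision alone.\<close>
  have "\<forall>\<^sub>F p in nhds x \<times>\<^sub>F sequentially. fst p \<in> \<X> \<longrightarrow> ereal c < G (fst p) z"
    using G_lsc[of x "\<lambda>_. z" z c] x K less by auto
  then have "\<forall>\<^sub>F y in nhds x. y \<in> \<X> \<longrightarrow> ereal c < G y z"
    using eventually_prod1[of sequentially "\<lambda>y. y \<in> \<X> \<longrightarrow> ereal c < G y z" "nhds x"]
    by (simp add: case_prod_unfold)
  then show "\<forall>\<^sub>F y in nhds x. y \<in> K \<longrightarrow> ereal c < G y z"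
    by eventually_elim (use K in blast)
qed

section \<open>Strict convexity and the unique minimiser\<close>

lemma G_strictly_convex:
  assumes x: "x \<in> \<X>" and y: "y \<in> \<X>" and "x \<noteq> y" and t: "0 < t" "t < 1"
  shows "G ((1 - t) *\<^sub>R x + t *\<^sub>R y) z < ereal (1 - t) * G x z + ereal t * G y z"
proof -
  define w where "w = (1 - t) *\<^sub>R x + t *\<^sub>R y"
  have w: "w \<in> \<X>"
    unfolding w_def using X(3) x y t by (intro convexD) auto
  \<comment> \<open>The maximiser is taken at the convex combination \<open>w\<close>: there
    \<open>G\<close> equals the translate of \<open>g\<close>, while at \<open>x\<close> and
    \<open>y\<close> it dominates that same translate. One strict inequality for \<open>g\<close>
    therefore suffices.\<close>
  obtain \<theta> \<kappa> where \<theta>: "\<theta> \<in> \<Theta>" "G w z = h w z \<theta>" "\<And>y. h y z \<theta> = ereal (g y \<theta> - \<kappa>)"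
    using G_attained_finite[OF w] by metis
  obtain a b where ab: "G x z = ereal a" "G y z = ereal b"
    using G_finite[OF x, of z] G_finite[OF y, of z] by fastforce
  have "g x \<theta> - \<kappa> \<le> a" "g y \<theta> - \<kappa> \<le> b"
    using objective_le_G[OF x \<theta>(1), of z] objective_le_G[OF y \<theta>(1), of z] by (auto simp: \<theta>(3) ab)
  then have "(1 - t) * (g x \<theta> - \<kappa>) \<le> (1 - t) * a" "t * (g y \<theta> - \<kappa>) \<le> t * b"
    using t by auto
  moreover have "g w \<theta> < (1 - t) * g x \<theta> + t * g y \<theta>"
    using g_convex[OF \<theta>(1)] x y t \<open>x \<noteq> y\<close> unfolding strictly_convex_on_def w_def by blast
  ultimately have "g w \<theta> - \<kappa> < (1 - t) * a + t * b" by (simp add: algebra_simps)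
  then show ?thesis by (simp add: ab \<theta>(2,3) flip: w_def)
qed

lemma arg_min_unique: "\<exists>!x. is_arg_min (\<lambda>x. G x z) (\<lambda>x. x \<in> \<X>) x"
proof (rule ex_ex1I)
  show "\<exists>x. is_arg_min (\<lambda>x. G x z) (\<lambda>x. x \<in> \<X>) x"
    using G_attains_min[OF X(2) _ X(1), of z] by (auto simp: is_arg_min_linorder)
next
  fix x y
  assume "is_arg_min (\<lambda>x. G x z) (\<lambda>x. x \<in> \<X>) x" "is_arg_min (\<lambda>x. G x z) (\<lambda>x. x \<in> \<X>) y"
  then have x: "x \<in> \<X>" "\<And>w. w \<in> \<X> \<Longrightarrow> G x z \<le> G w z" and y: "y \<in> \<X>" "G y z \<le> G x z"
    by (auto simp: is_arg_min_linorder)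
  then have eq: "G y z = G x z" by (simp add: antisym)
  obtain a where a: "G x z = ereal a" using G_finite[OF x(1), of z] by auto
  show "x = y"
  proof (rule ccontr)
    assume "x \<noteq> y"
    \<comment> \<open>The midpoint of two distinct minimisers would lie strictly below the
      minimum.\<close>
    from G_strictly_convex[OF x(1) y(1) this, of "1/2" z]
    have "G ((1 - 1/2) *\<^sub>R x + (1/2) *\<^sub>R y) z < G x z" by (simp add: eq a)
    moreover have "(1 - 1/2) *\<^sub>R x + (1/2) *\<^sub>R y \<in> \<X>"
      using X(3) x y by (intro convexD) auto
    ultimately show False using x(2) by (meson not_le)
  qed
qed

lemma X_star_arg_min: "is_arg_min (\<lambda>x. G x z) (\<lambda>x. x \<in> \<X>) (Xs z)"
  unfolding X_star_def using arg_min_unique by (rule theI')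

lemma X_star_mem: "Xs z \<in> \<X>"
  using X_star_arg_min by (simp add: is_arg_min_linorder)

lemma G_X_star_le: "x \<in> \<X> \<Longrightarrow> G (Xs z) z \<le> G x z"
  using X_star_arg_min by (simp add: is_arg_min_linorder)

lemma G_X_star_less:
  assumes "x \<in> \<X>" "x \<noteq> Xs z" shows "G (Xs z) z < G x z"
proof (rule ccontr)
  assume "\<not> ?thesis"
  then have "is_arg_min (\<lambda>x. G x z) (\<lambda>x. x \<in> \<X>) x"
    using assms(1) G_X_star_le by (auto simp: is_arg_min_linorder not_less intro: order_trans)
  then show False using arg_min_unique X_star_arg_min assms(2) by blast
qed

lemma u_star_eq: "ereal (us z) = G (Xs z) z"
proof -
  have "(LEAST v. v \<in> (\<lambda>x. G x z) ` \<X>) = G (Xs z) z"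
    by (rule Least_equality) (auto simp: X_star_mem G_X_star_le)
  then show ?thesis
    unfolding u_star_def using G_finite[OF X_star_mem] by (simp add: ereal_real')
qed

section \<open>Continuity of the minimal value and of the minimiser\<close>

lemma u_star_cont: "continuous_on UNIV us"
proof (rule continuous_on_UNIV_sequentially, rule order_tendstoI)
  fix zs :: "nat \<Rightarrow> 'z" and z c assume zs: "zs \<longlonglongrightarrow> z"
  show "\<forall>\<^sub>F n in sequentially. c < us (zs n)" if "c < us z"
  proof -
    have "ereal c < G x z" if "x \<in> \<X>" for x
      using \<open>c < us z\<close> G_X_star_le[OF that, of z] u_star_eq[of z]
      by (metis less_ereal.simps(1) less_le_trans)
    then have "\<forall>\<^sub>F n in sequentially. \<forall>x\<in>\<X>. ereal c < G x (zs n)"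
      by (intro G_lsc_uniform[OF X(2) order_refl zs]) auto
    then show ?thesis by eventually_elim (metis X_star_mem less_ereal.simps(1) u_star_eq)
  qed
  show "\<forall>\<^sub>F n in sequentially. us (zs n) < c" if "us z < c"
  proof -
    \<comment> \<open>For the upper bound the minimiser at \<open>z\<close> is kept as a competitor
      at \<open>zs n\<close>.\<close>
    have "G (Xs z) z < ereal c" using that by (simp flip: u_star_eq)
    from G_usc[OF X_star_mem this] have "\<forall>\<^sub>F n in sequentially. G (Xs z) (zs n) < ereal c"
      by (rule eventually_compose_filterlim[OF _ zs])
    then show ?thesis
      by eventually_elim (metis G_X_star_le X_star_mem le_less_trans less_ereal.simps(1) u_star_eq)
  qed
qed

lemma X_star_cont: "continuous_on UNIV Xs"
proof (rule continuous_on_UNIV_sequentially, rule topological_tendstoI)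
  fix zs z W assume zs: "zs \<longlonglongrightarrow> z" and W: "open W" "Xs z \<in> W"
  have K: "compact (\<X> - W)" using X(2) W(1) by (rule compact_diff)
  obtain c where c: "G (Xs z) z < ereal c" "\<And>x. x \<in> \<X> - W \<Longrightarrow> ereal c < G x z"
  proof (cases "\<X> - W = {}")
    case True
    \<comment> \<open>With nothing outside \<open>W\<close> to separate from, any number above the
      minimum serves.\<close>
    have "G (Xs z) z < ereal (us z + 1)" by (simp flip: u_star_eq)
    with True show ?thesis by (intro that) auto
  next
    case False
    \<comment> \<open>Uniqueness makes the minimum over the compact remainder strictly larger, which
      leaves room for \<open>c\<close>.\<close>
    then obtain y where y: "y \<in> \<X> - W" "\<And>x. x \<in> \<X> - W \<Longrightarrow> G y z \<le> G x z"
      using G_attains_min[OF K, of z] by auto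
    then have "G (Xs z) z < G y z" using W by (intro G_X_star_less) auto
    then obtain c where "G (Xs z) z < ereal c" "ereal c < G y z" using ereal_dense2 by blast
    with y show ?thesis by (intro that[of c]) (auto intro: less_le_trans)
  qed
  have "\<forall>\<^sub>F n in sequentially. \<forall>x\<in>\<X> - W. ereal c < G x (zs n)"
    using c(2) by (intro G_lsc_uniform[OF K _ zs]) auto
  moreover have "\<forall>\<^sub>F n in sequentially. G (Xs z) (zs n) < ereal c"
    using G_usc[OF X_star_mem c(1)] by (rule eventually_compose_filterlim[OF _ zs])
  ultimately show "\<forall>\<^sub>F n in sequentially. Xs (zs n) \<in> W"
  proof eventually_elim
    case (elim n)
    then have "\<not> ereal c < G (Xs (zs n)) (zs n)"
      using G_X_star_le[OF X_star_mem[of z], of "zs n"] by (simp add: not_less le_less_trans less_imp_le)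
    then show ?case using elim(1) X_star_mem[of "zs n"] by blast
  qed
qed

end


section \<open>From the risk constraint to the pointwise problem\<close>

theorem theorem3p2:
  fixes \<Theta> :: "'t::real_tvs set"
    and \<X> :: "'x::real_tvs set"
    and M :: "'w measure"
    and P :: "'t \<Rightarrow> 'w measure"
    and Z :: "nat \<Rightarrow> 'w \<Rightarrow> 'z::metric_space"
    and g :: "'x \<Rightarrow> 't \<Rightarrow> real"
    and l :: "real \<Rightarrow> real"
    and r :: real
    and \<phi> :: "'t \<Rightarrow> (nat \<Rightarrow> 'w \<Rightarrow> real) \<Rightarrow> ereal"
    and I :: "'t \<Rightarrow> 'z \<Rightarrow> ereal"
  assumes Theta: "\<Theta> \<noteq> {}" "compact \<Theta>" "convex \<Theta>" "metrizable_space (top_of_set \<Theta>)"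
    and X: "\<X> \<noteq> {}" "compact \<X>" "convex \<X>" "metrizable_space (top_of_set \<X>)"
    and P: "\<And>\<theta>. \<theta> \<in> \<Theta> \<Longrightarrow> prob_space (P \<theta>)"
           "\<And>\<theta>. \<theta> \<in> \<Theta> \<Longrightarrow> sets (P \<theta>) = sets M"
    and Z: "\<And>n. Z n \<in> borel_measurable M"
    and g_cont: "continuous_on (\<X> \<times> \<Theta>) (\<lambda>(x, \<theta>). g x \<theta>)"
    and g_convex: "\<And>\<theta>. \<theta> \<in> \<Theta> \<Longrightarrow> strictly_convex_on \<X> (\<lambda>x. g x \<theta>)"
    and l: "penalty l"
    and r: "r > 0"
    and I_nonneg: "\<And>\<theta> z. \<theta> \<in> \<Theta> \<Longrightarrow> 0 \<le> I \<theta> z"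
    and laplace: "\<And>\<theta> f. \<theta> \<in> \<Theta> \<Longrightarrow> continuous_on UNIV f \<Longrightarrow>
                    \<phi> \<theta> (\<lambda>n \<omega>. f (Z n \<omega>)) = (SUP z. ereal (f z) - I \<theta> z)"
    and I_finite: "\<And>z. \<exists>\<theta>\<in>\<Theta>. I \<theta> z < \<infinity>"
    and I_lsc: "lower_semicontinuous_on (\<Theta> \<times> UNIV) (\<lambda>(\<theta>, z). I \<theta> z)"
    and I_recovery: "\<And>\<theta> z zs. \<theta> \<in> \<Theta> \<Longrightarrow> I \<theta> z < \<infinity> \<Longrightarrow> zs \<longlonglongrightarrow> z \<Longrightarrow>
                    \<exists>\<theta>s. (\<forall>n. \<theta>s n \<in> \<Theta>) \<and> \<theta>s \<longlonglongrightarrow> \<theta> \<and> (\<lambda>n. I (\<theta>s n) (zs n)) \<longlonglongrightarrow> I \<theta> z"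
  shows "(\<forall>z. (\<forall>x\<in>\<X>. (\<exists>\<theta>. is_arg_max (objective g l r I x z) (\<lambda>\<theta>. \<theta> \<in> \<Theta>) \<theta>) \<and>
                      \<bar>G_fun \<Theta> g l r I x z\<bar> \<noteq> \<infinity>) \<and>
              (\<exists>!x. is_arg_min (\<lambda>x. G_fun \<Theta> g l r I x z) (\<lambda>x. x \<in> \<X>) x)) \<and>
         feasible \<X> \<Theta> g l r \<phi> Z (X_star \<X> \<Theta> g l r I) (u_star \<X> \<Theta> g l r I) \<and>
         (\<forall>X u. feasible \<X> \<Theta> g l r \<phi> Z X u \<longrightarrow> (\<forall>z. u_star \<X> \<Theta> g l r I z \<le> u z))"
proof -
  interpret robust_problem \<Theta> \<X> g l r I
    by (rule robust_problem.intro) fact+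

  have risk: "(\<forall>\<theta>\<in>\<Theta>. \<phi> \<theta> (\<lambda>n \<omega>. l (g (X (Z n \<omega>)) \<theta> - u (Z n \<omega>))) \<le> - ereal r) \<longleftrightarrow>
      (\<forall>z. G (X z) z \<le> ereal (u z))"
    if X: "continuous_on UNIV X" "range X \<subseteq> \<X>" and u: "continuous_on UNIV u" for X u
  proof -
    have "\<phi> \<theta> (\<lambda>n \<omega>. l (g (X (Z n \<omega>)) \<theta> - u (Z n \<omega>))) \<le> - ereal r \<longleftrightarrow>
        (\<forall>z. objective g l r I (X z) z \<theta> \<le> ereal (u z))" if \<theta>: "\<theta> \<in> \<Theta>" for \<theta>
    proof -
      have "continuous_on UNIV (\<lambda>z. g (X z) \<theta>)"
        using continuous_on_compose2[OF g_cont continuous_on_Pair[OF X(1) continuous_on_const[of _ \<theta>]]] X(2) \<theta>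
        by (auto simp: image_subset_iff)
      then have "continuous_on UNIV (\<lambda>z. g (X z) \<theta> - u z)"
        using u by (rule continuous_on_diff)
      moreover have "continuous_on UNIV l" using l by (simp add: penalty_def)
      ultimately have "continuous_on UNIV (\<lambda>z. l (g (X z) \<theta> - u z))"
        using continuous_on_compose2[of UNIV l] by blast
      \<comment> \<open>The supremum is at most \<open>-r\<close> exactly when each of its terms is,
        and by \<open>objective_le_iff\<close> each term is a bound on the objective.\<close>
      from laplace[OF \<theta> this] show ?thesis
        by (simp add: SUP_le_iff objective_le_iff[OF l])
    qed
    \<comment> \<open>After exchanging the quantifiers over \<theta> and \<open>z\<close>, the
      bounds for all \<theta> combine into one on \<open>G\<close>, as it is an attained
      maximum.\<close>
    moreover have "(\<forall>\<theta>\<in>\<Theta>. objective g l r I (X z) z \<theta> \<le> ereal (u z)) \<longleftrightarrow> G (X z) z \<le> ereal (u z)" for z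
    proof -
      have x: "X z \<in> \<X>" using X by auto
      show ?thesis using G_attained[OF x, of z] objective_le_G[OF x, of _ z] by (metis order_trans)
    qed
    ultimately show ?thesis by blast
  qed

  have "feasible \<X> \<Theta> g l r \<phi> Z Xs us"
    unfolding feasible_def using risk[OF X_star_cont _ u_star_cont] X_star_cont u_star_cont X_star_mem
    by (auto simp: u_star_eq)
  moreover have "us z \<le> u z" if "feasible \<X> \<Theta> g l r \<phi> Z X u" for X u z
  proof -
    have X: "continuous_on UNIV X" "range X \<subseteq> \<X>" and u: "continuous_on UNIV u"
      using that by (auto simp: feasible_def)
    \<comment> \<open>The value \<open>X z\<close> of any feasible rule is a competitor in the
      minimisation at \<open>z\<close>.\<close>
    have "ereal (us z) \<le> G (X z) z" using X(2) by (auto simp: u_star_eq intro: G_X_star_le)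
    also have "\<dots> \<le> ereal (u z)" using risk[OF X u] that by (auto simp: feasible_def)
    finally show ?thesis by simp
  qed
  ultimately show ?thesis
    using objective_arg_max G_finite arg_min_unique by (intro conjI allI ballI impI) auto
qed

end
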